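(* Let $\mathcal{U}\subseteq\mathbb{R}^n$ be an open set and let $S\subseteq\mathcal{U}$ be a nonempty convex and compact set. Let $h:\mathcal{U}\to\mathbb{R}$ be a $\nu$-weakly convex function for some $\nu\in(0,1]$. Then $h$ is a $\nu$-paraconvex function on $S$.
   Context: $\|\cdot\|$ is the Euclidean norm and $\mathbb{B}(x_0;\varepsilon)$ is the open ball with center $x_0$ and radius $\varepsilon$. For a nonempty open set $\mathcal{U}\subseteq\mathbb{R}^n$ and $0<\nu\le1$, a locally Lipschitz function $\varphi:\mathcal{U}\to\mathbb{R}$ is called $\nu$-weakly convex if for every $x_0\in\mathcal{U}$ there exist $\varepsilon>0$ and $C>0$ such that for all $x,y\in\mathbb{B}(x_0;\varepsilon)$ and $\lambda\in[0,1]$, $$\varphi(\lambda x+(1-\lambda)y)\le\lambda\varphi(x)+(1-\lambda)\varphi(y)+C\lambda(1-\lambda)\|x-y\|^{1+\nu}.$$ A function $h$ is called $\nu$-paraconvex on a convex set $S$ (contained in the set where $h$ is finite) if there exists $\rho>0$ such that for all $x,y\in S$ and $\lambda\in[0,1]$, $$h(\lambda x+(1-\lambda)y)\le\lambda h(x)+(1-\lambda)h(y)+\rho\min\{\lambda,1-\lambda\}\|x-y\|^{1+\nu}.$$ *)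

theory Defs
  imports "HOL-Analysis.Analysis"
begin

(* The library constant local_lipschitz is about families of functions with a time parameter. *)
definition locally_lipschitz_on :: "'a::metric_space set \<Rightarrow> ('a \<Rightarrow> 'b::metric_space) \<Rightarrow> bool" where
  "locally_lipschitz_on U f \<longleftrightarrow>
     (\<forall>x\<in>U. \<exists>\<epsilon>>0. \<exists>L. L-lipschitz_on (ball x \<epsilon> \<inter> U) f)"

(* Meant for U nonempty and open and 0 < nu <= 1.  A function U -> R is a total function of which
   only the values on U matter; hence the explicit requirement that the ball lies in U. *)
definition weakly_convex_on :: "real \<Rightarrow> 'a::real_normed_vector set \<Rightarrow> ('a \<Rightarrow> real) \<Rightarrow> bool" where
  "weakly_convex_on \<nu> U \<phi> \<longleftrightarrow>
     locally_lipschitz_on U \<phi> \<and>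
     (\<forall>x0\<in>U. \<exists>\<epsilon>>0. \<exists>C>0. ball x0 \<epsilon> \<subseteq> U \<and>
        (\<forall>x\<in>ball x0 \<epsilon>. \<forall>y\<in>ball x0 \<epsilon>. \<forall>t\<in>{0..1}.
           \<phi> (t *\<^sub>R x + (1 - t) *\<^sub>R y)
             \<le> t * \<phi> x + (1 - t) * \<phi> y + C * t * (1 - t) * norm (x - y) powr (1 + \<nu>)))"

(* Meant for S convex and contained in the set on which h is defined. *)
definition paraconvex_on :: "real \<Rightarrow> 'a::real_normed_vector set \<Rightarrow> ('a \<Rightarrow> real) \<Rightarrow> bool" where
  "paraconvex_on \<nu> S h \<longleftrightarrow>
     (\<exists>\<rho>>0. \<forall>x\<in>S. \<forall>y\<in>S. \<forall>t\<in>{0..1}.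
        h (t *\<^sub>R x + (1 - t) *\<^sub>R y)
          \<le> t * h x + (1 - t) * h y + \<rho> * min t (1 - t) * norm (x - y) powr (1 + \<nu>))"

end

theory Submission
  imports Defs
begin

text \<open>
  Weak convexity gives the desired inequality, with a constant, only for points that lie in a common
  small ball. Compactness of \<open>S\<close> makes this uniform: there are \<open>\<delta> > 0\<close> and \<open>C\<close> such that the inequality
  holds with \<open>C\<close> for all \<open>x, y \<in> S\<close> at distance less than \<open>\<delta>\<close>
  (\<open>weakly_convex_on_compact_uniform\<close>), and \<open>t (1 - t) \<le> min t (1 - t)\<close>.

  For points at distance at least \<open>\<delta>\<close> the Lipschitz property takes over. A locally Lipschitz function is
  Lipschitz on a compact set (\<open>locally_lipschitz_on_compact\<close>), and a Lipschitz function exceeds its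
  chord by at most \<open>2 L min t (1 - t) \<parallel>x - y\<parallel>\<close> (\<open>lipschitz_on_chord\<close>). This error is
  linear in the distance, hence worse than \<open>\<parallel>x - y\<parallel>\<^sup>1\<^sup>+\<^sup>\<nu>\<close> near the diagonal, but for
  \<open>\<parallel>x - y\<parallel> \<ge> \<delta>\<close> it costs only a factor \<open>\<delta>\<^sup>-\<^sup>\<nu>\<close>. The larger of \<open>C\<close> and \<open>2 L \<delta>\<^sup>-\<^sup>\<nu>\<close>
  therefore serves all pairs.
\<close>

text \<open>
  Uniform local Lipschitz constants on compact sets exist in the theory of time-dependent families;
  a single function is the family over a one-point set of times.
\<close>
lemma locally_lipschitz_on_compact:
  fixes f :: "'a::metric_space \<Rightarrow> 'b::metric_space"
  assumes "locally_lipschitz_on U f" "S \<subseteq> U" "compact S"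
  obtains L where "L-lipschitz_on S f"
proof -
  have "local_lipschitz {0::real} S (\<lambda>_. f)"
  proof (rule local_lipschitzI)
    fix t :: real and x
    assume "t \<in> {0}" "x \<in> S"
    then obtain e L where "e > 0" and L: "L-lipschitz_on (ball x e \<inter> U) f"
      using assms(1,2) unfolding locally_lipschitz_on_def by blast
    moreover have "cball x (e/2) \<inter> S \<subseteq> ball x e \<inter> U"
      using \<open>e > 0\<close> assms(2) by auto
    ultimately show "\<exists>u>0. \<exists>L. \<forall>t\<in>cball t u \<inter> {0}. L-lipschitz_on (cball x u \<inter> S) f"
      by (meson half_gt_zero lipschitz_on_subset)
  qed
  then obtain L where "\<And>t. t \<in> {0::real} \<Longrightarrow> L-lipschitz_on S f"
    by (rule local_lipschitz_compact_implies_lipschitz) (use assms(3) in auto)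
  then show thesis
    using that by blast
qed

text \<open>
  Going from \<open>y\<close> to the point \<open>t x + (1 - t) y\<close> changes both the function and its chord by at most
  \<open>L t \<parallel>x - y\<parallel>\<close>, and going from \<open>x\<close> by at most \<open>L (1 - t) \<parallel>x - y\<parallel>\<close>; the minimum comes from
  starting at the nearer endpoint.
\<close>
lemma lipschitz_on_chord:
  fixes h :: "'a::real_normed_vector \<Rightarrow> real"
  assumes lip: "L-lipschitz_on S h" and "convex S" and "x \<in> S" "y \<in> S" and t: "t \<in> {0..1}"
  shows "h (t *\<^sub>R x + (1 - t) *\<^sub>R y)
           \<le> t * h x + (1 - t) * h y + 2 * L * min t (1 - t) * norm (x - y)"
proof -
  define z where "z = t *\<^sub>R x + (1 - t) *\<^sub>R y"
  have "z \<in> S"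
    using assms by (auto simp: z_def convexD)
  have "z - y = t *\<^sub>R (x - y)" "z - x = (1 - t) *\<^sub>R (y - x)"
    by (simp_all add: z_def algebra_simps)
  then have "dist z y = t * norm (x - y)" "dist z x = (1 - t) * norm (x - y)"
    using t by (simp_all add: dist_norm norm_minus_commute)
  then have zy: "h z - h y \<le> L * (t * norm (x - y))"
    and zx: "h z - h x \<le> L * ((1 - t) * norm (x - y))"
    using lipschitz_onD[OF lip \<open>z \<in> S\<close>] \<open>x \<in> S\<close> \<open>y \<in> S\<close>
    by (force simp: dist_real_def)+
  have xy: "\<bar>h x - h y\<bar> \<le> L * norm (x - y)"
    using lipschitz_onD[OF lip \<open>x \<in> S\<close> \<open>y \<in> S\<close>] by (simp add: dist_norm)
  have "t * (h y - h x) \<le> t * (L * norm (x - y))"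
    "(1 - t) * (h x - h y) \<le> (1 - t) * (L * norm (x - y))"
    using xy t by (auto intro!: mult_left_mono)
  then show ?thesis
    using zy zx unfolding z_def[symmetric] min_def by (auto simp: algebra_simps)
qed

text \<open>
  Finitely many of the balls from the definition cover \<open>S\<close>, so one constant works in all of them;
  \<open>\<delta>\<close> is a Lebesgue number of this finite cover.
\<close>
lemma weakly_convex_on_compact_uniform:
  fixes \<phi> :: "'a::real_normed_vector \<Rightarrow> real"
  assumes wc: "weakly_convex_on \<nu> U \<phi>" and "S \<subseteq> U" and "compact S"
  obtains C \<delta> where "C > 0" "\<delta> > 0"
    "\<And>x y t. \<lbrakk>x \<in> S; dist x y < \<delta>; t \<in> {0..1}\<rbrakk> \<Longrightarrow>
       \<phi> (t *\<^sub>R x + (1 - t) *\<^sub>R y)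
         \<le> t * \<phi> x + (1 - t) * \<phi> y + C * t * (1 - t) * norm (x - y) powr (1 + \<nu>)"
proof -
  have "\<forall>a\<in>S. \<exists>e C. e > 0 \<and> (\<forall>x\<in>ball a e. \<forall>y\<in>ball a e. \<forall>t\<in>{0..1}.
           \<phi> (t *\<^sub>R x + (1 - t) *\<^sub>R y)
             \<le> t * \<phi> x + (1 - t) * \<phi> y + C * t * (1 - t) * norm (x - y) powr (1 + \<nu>))"
    using wc \<open>S \<subseteq> U\<close> unfolding weakly_convex_on_def by blast
  then obtain e c where e: "\<And>a. a \<in> S \<Longrightarrow> e a > 0"
    and c: "\<And>a x y t. \<lbrakk>a \<in> S; x \<in> ball a (e a); y \<in> ball a (e a); t \<in> {0..1}\<rbrakk> \<Longrightarrow>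
           \<phi> (t *\<^sub>R x + (1 - t) *\<^sub>R y)
             \<le> t * \<phi> x + (1 - t) * \<phi> y + c a * t * (1 - t) * norm (x - y) powr (1 + \<nu>)"
    by metis
  obtain D where D: "D \<subseteq> S" "finite D" "S \<subseteq> (\<Union>a\<in>D. ball a (e a))"
  proof (rule compactE_image[OF \<open>compact S\<close>])
    show "S \<subseteq> (\<Union>a\<in>S. ball a (e a))"
      using e by auto
  qed auto
  obtain \<delta> where "\<delta> > 0" and \<delta>: "\<And>x. x \<in> S \<Longrightarrow> \<exists>G\<in>(\<lambda>a. ball a (e a)) ` D. ball x \<delta> \<subseteq> G"
    using Heine_Borel_lemma[OF \<open>compact S\<close> D(3)] by auto
  \<comment> \<open>The element 1 keeps \<open>C\<close> positive even if the cover is empty.\<close>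
  define C where "C = Max (insert 1 (c ` D))"
  have C: "C \<ge> 1" "\<And>a. a \<in> D \<Longrightarrow> c a \<le> C"
    using D(2) by (auto simp: C_def)
  show thesis
  proof (rule that)
    fix x y t
    assume "x \<in> S" "dist x y < \<delta>" and t: "t \<in> {0..1::real}"
    then obtain a where a: "a \<in> D" "ball x \<delta> \<subseteq> ball a (e a)"
      using \<delta> by blast
    moreover have "x \<in> ball x \<delta>" "y \<in> ball x \<delta>"
      using \<open>\<delta> > 0\<close> \<open>dist x y < \<delta>\<close> by auto
    ultimately have "x \<in> ball a (e a)" "y \<in> ball a (e a)"
      by blast+
    then have "\<phi> (t *\<^sub>R x + (1 - t) *\<^sub>R y)
        \<le> t * \<phi> x + (1 - t) * \<phi> y + c a * t * (1 - t) * norm (x - y) powr (1 + \<nu>)"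
      using c a(1) D(1) t by blast
    also have "c a * t * (1 - t) * norm (x - y) powr (1 + \<nu>)
        \<le> C * t * (1 - t) * norm (x - y) powr (1 + \<nu>)"
      using t C(2)[OF a(1)] by (auto intro!: mult_right_mono)
    finally show "\<phi> (t *\<^sub>R x + (1 - t) *\<^sub>R y)
        \<le> t * \<phi> x + (1 - t) * \<phi> y + C * t * (1 - t) * norm (x - y) powr (1 + \<nu>)"
      by simp
  qed (use C(1) \<open>\<delta> > 0\<close> in auto)
qed

theorem theorem3p7:
  fixes U S :: "(real ^ 'n) set" and h :: "real ^ 'n \<Rightarrow> real" and \<nu> :: real
  assumes "open U"
    and "S \<subseteq> U" and "S \<noteq> {}" and "convex S" and "compact S"
    and "0 < \<nu>" and "\<nu> \<le> 1"
    and "weakly_convex_on \<nu> U h"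
  shows "paraconvex_on \<nu> S h"
proof -
  obtain C \<delta> where "C > 0" "\<delta> > 0" and near:
    "\<And>x y t. \<lbrakk>x \<in> S; dist x y < \<delta>; t \<in> {0..1}\<rbrakk> \<Longrightarrow>
       h (t *\<^sub>R x + (1 - t) *\<^sub>R y)
         \<le> t * h x + (1 - t) * h y + C * t * (1 - t) * norm (x - y) powr (1 + \<nu>)"
    using weakly_convex_on_compact_uniform[OF assms(8,2,5)] by metis
  obtain L where L: "L-lipschitz_on S h"
    using locally_lipschitz_on_compact assms(2,5,8) unfolding weakly_convex_on_def by metis
  have "L \<ge> 0"
    using L by (rule lipschitz_on_nonneg)
  define \<rho> where "\<rho> = max C (2 * L / \<delta> powr \<nu>)"
  have "h (t *\<^sub>R x + (1 - t) *\<^sub>R y)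
      \<le> t * h x + (1 - t) * h y + \<rho> * min t (1 - t) * norm (x - y) powr (1 + \<nu>)"
    if "x \<in> S" "y \<in> S" and t: "t \<in> {0..1}" for x y t
  proof (cases "dist x y < \<delta>")
    case True
    have "t * (1 - t) \<le> min t (1 - t)"
      using t by (auto simp: mult_left_le mult_left_le_one_le)
    then have "C * (t * (1 - t)) \<le> \<rho> * min t (1 - t)"
      using \<open>C > 0\<close> t by (intro mult_mono) (auto simp: \<rho>_def)
    then have "C * t * (1 - t) * norm (x - y) powr (1 + \<nu>)
        \<le> \<rho> * min t (1 - t) * norm (x - y) powr (1 + \<nu>)"
      by (intro mult_right_mono) (simp_all add: mult.assoc)
    then show ?thesis
      using near[OF \<open>x \<in> S\<close> True t] by linarith
  next
    case False
    define d where "d = norm (x - y)"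
    have "\<delta> \<le> d"
      using False by (simp add: d_def dist_norm)
    have "2 * L = 2 * L / \<delta> powr \<nu> * \<delta> powr \<nu>"
      using \<open>\<delta> > 0\<close> by simp
    also have "\<dots> \<le> \<rho> * d powr \<nu>"
      using \<open>\<delta> > 0\<close> \<open>\<delta> \<le> d\<close> \<open>L \<ge> 0\<close> \<open>C > 0\<close> \<open>0 < \<nu>\<close>
      by (intro mult_mono powr_mono2) (auto simp: \<rho>_def)
    finally have "2 * L * (min t (1 - t) * d) \<le> \<rho> * d powr \<nu> * (min t (1 - t) * d)"
      using t \<open>\<delta> > 0\<close> \<open>\<delta> \<le> d\<close> by (intro mult_right_mono) auto
    also have "\<dots> = \<rho> * min t (1 - t) * d powr (1 + \<nu>)"
      using \<open>\<delta> > 0\<close> \<open>\<delta> \<le> d\<close> by (simp add: powr_add mult_ac)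
    finally show ?thesis
      using lipschitz_on_chord[OF L \<open>convex S\<close> \<open>x \<in> S\<close> \<open>y \<in> S\<close> t]
      by (simp add: d_def mult.assoc)
  qed
  moreover have "\<rho> > 0"
    using \<open>C > 0\<close> by (simp add: \<rho>_def)
  ultimately show ?thesis
    unfolding paraconvex_on_def by blast
qed

end
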